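(* Let $p$ be a prime number, and let $g(x) = b_e x^e + b_{e-1} x^{e-1} + \cdots + b_0$ with $b_0 \neq 0$ be a polynomial of degree $e$ with rational coefficients. Let $m_0, m_1, \dots, m_{t-1}, m_t$ be integers, with $m_0=e$ and $m_t=0$, such that the successive vertices of the Newton polygon of $g(x)$ with respect to $p$ are given by the set $$\{(0, \nu_p(b_e)), (e - m_1, \nu_p(b_{m_1})), \dots, (e - m_{t-1}, \nu_p(b_{m_{t-1}})), (e, \nu_p(b_0))\},$$ and put $\lambda_i = \frac{\nu_p(b_{m_i}) - \nu_p(b_{m_{i-1}})}{m_{i-1} - m_i}$ for $1 \leq i \leq t$. Let $u$ be an integer such that $u > |\lambda_j|$ for all $j \in \{1,2, \ldots, t\}$. Suppose $f(x) = a_d x^d + \cdots + a_1 x + a_0\in\mathbb{Q}[x]$ is a polynomial of degree $d$ such that $\nu_p(a_d)=0$ and $\nu_p(a_i) \geq \frac{u}{\beta} (d-i)$ for all $i \in \{ 0,1,2, \ldots, d \}$, where $\beta \leq d$ is a positive integer coprime to $u$. Then the successive vertices of the Newton polygon of the composition $g(f(x))$ with respect to $p$ are given by the set $$\{(0, \nu_p(b_e)), (d(e - m_1), \nu_p(b_{m_1})), \dots, (d(e - m_{t-1}), \nu_p(b_{m_{t-1}})), (de, \nu_p(b_0))\}.$$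
   Context: $\nu_p$ denotes the $p$-adic valuation on $\mathbb{Q}$, with $\nu_p(0)=+\infty$. For a polynomial $h(x)=\sum_{i=0}^{N} c_i x^i\in\mathbb{Q}[x]$ of degree $N$ with $h(0)\neq 0$, the Newton polygon of $h$ with respect to $p$ is the polygonal path formed by the lower edges along the convex hull in $\mathbb{R}^2$ of the points $(N-i,\nu_p(c_i))$, $0\le i\le N$ (points with $c_i=0$ are ignored). Its successive vertices, listed from left to right, are its two endpoints and the points where the slope changes. *)

theory Defs
  imports
    "HOL-Analysis.Analysis"
    "HOL-Computational_Algebra.Computational_Algebra"
begin

definition padic_val :: "nat \<Rightarrow> rat \<Rightarrow> ereal" where
  "padic_val p q =
     (if q = 0 then \<infinity>
      else ereal (real (multiplicity (int p) (fst (quotient_of q)))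
                - real (multiplicity (int p) (snd (quotient_of q)))))"

text \<open>Requiring the valuation to be a real number \<open>y\<close> discards the zero coefficients.\<close>

definition newton_points :: "nat \<Rightarrow> rat poly \<Rightarrow> (real \<times> real) set" where
  "newton_points p h =
     {(real (degree h - i), y) | i y. i \<le> degree h \<and> padic_val p (coeff h i) = ereal y}"

definition newton_polygon :: "nat \<Rightarrow> rat poly \<Rightarrow> (real \<times> real) set" where
  "newton_polygon p h =
     {(x, y). (x, y) \<in> convex hull newton_points p h \<and>
              (\<forall>y'. (x, y') \<in> convex hull newton_points p h \<longrightarrow> y \<le> y')}"

text \<open>The path \<open>L\<close> has slope \<open>s\<close> immediately to the left of the point and a different
  slope \<open>s'\<close> immediately to its right.\<close>

definition slope_changes_at :: "(real \<times> real) set \<Rightarrow> real \<times> real \<Rightarrow> bool" where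
  "slope_changes_at L P \<longleftrightarrow>
     (\<exists>s s' \<delta>. s \<noteq> s' \<and> \<delta> > 0 \<and>
        (\<forall>r\<in>{0..\<delta>}. (fst P - r, snd P - s * r) \<in> L \<and> (fst P + r, snd P + s' * r) \<in> L))"

definition newton_vertices :: "nat \<Rightarrow> rat poly \<Rightarrow> (real \<times> real) set" where
  "newton_vertices p h =
     {P \<in> newton_polygon p h.
        fst P = 0 \<or> fst P = real (degree h) \<or> slope_changes_at (newton_polygon p h) P}"

text \<open>The list \<open>vs\<close> enumerates the vertices from left to right.  Its second coordinates are
  extended reals so that valuations can be listed directly; such a list can only contain finite
  ones.  The Newton polygon is only considered for polynomials with nonzero constant term.\<close>

definition successive_newton_vertices :: "nat \<Rightarrow> rat poly \<Rightarrow> (real \<times> ereal) list \<Rightarrow> bool" where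
  "successive_newton_vertices p h vs \<longleftrightarrow>
     coeff h 0 \<noteq> 0 \<and>
     sorted_wrt (\<lambda>P Q. fst P < fst Q) vs \<and>
     set vs = (\<lambda>(x, y). (x, ereal y)) ` newton_vertices p h"

end

theory Submission
  imports Defs
begin

text \<open>The Newton polygon of \<open>g \<circ> f\<close> is the image of that of \<open>g\<close> under
  \<open>(x, y) \<mapsto> (d x, y)\<close>.  Since \<open>\<beta> \<le> d\<close>, the coefficient of the \<open>j\<close>-th power of \<open>f\<close> in degree
  \<open>k\<close> has valuation at least \<open>u z\<close> with \<open>z = j - k/d\<close>.  As \<open>u\<close> exceeds every \<open>\<lambda>\<^sub>i\<close>, its product with
  \<open>b\<^sub>j\<close> contributes a point on or above the stretched line through each edge of the polygon of \<open>g\<close>,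
  strictly above unless \<open>z = 0\<close>.  In degree \<open>k = d m\<^sub>i\<close> only \<open>j = m\<^sub>i\<close> has \<open>z = 0\<close>, so the stretched
  vertex is attained.  Consecutive vertices span supporting lines because a maximal edge starting
  at a vertex ends at a vertex, and no slope change occurs in its interior.\<close>

section \<open>The p-adic valuation\<close>

lemma padic_val_0 [simp]: "padic_val p 0 = \<infinity>"
  by (simp add: padic_val_def)

text \<open>\<open>padic_val\<close> is defined through the reduced fraction. Cross-multiplying with
  it and additivity of multiplicity at a prime give the same difference for every other fraction, so
  common denominators may be used.\<close>

lemma padic_val_divide_of_int:
  assumes "prime p" "a \<noteq> 0" "b \<noteq> 0"
  shows "padic_val p (of_int a / of_int b) =
           ereal (real (multiplicity (int p) a) - real (multiplicity (int p) b))"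
proof -
  define q :: rat where "q = of_int a / of_int b"
  obtain n k where nk: "quotient_of q = (n, k)"
    by fastforce
  have k: "k > 0" and q: "q = of_int n / of_int k"
    using nk quotient_of_denom_pos quotient_of_div by blast+
  have "q \<noteq> 0"
    using assms by (simp add: q_def)
  then have n: "n \<noteq> 0"
    using q by auto
  have "(of_int (a * k) :: rat) = of_int (n * b)"
    using q k assms by (simp add: q_def field_simps)
  then have "a * k = n * b"
    by (simp only: of_int_eq_iff)
  moreover have "prime_elem (int p)"
    using assms by simp
  ultimately have "multiplicity (int p) a + multiplicity (int p) k =
      multiplicity (int p) n + multiplicity (int p) b"
    using n k assms
    by (metis prime_elem_multiplicity_mult_distrib less_irrefl)
  then show ?thesis
    using \<open>q \<noteq> 0\<close> nk unfolding q_def[symmetric] padic_val_def by simp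
qed

lemma rat_eq_divide_of_int:
  obtains a b :: int where "q = of_int a / (of_int b :: rat)" "b \<noteq> 0"
  by (metis less_irrefl quotient_of_denom_pos quotient_of_div surj_pair)

lemma padic_val_mult:
  assumes "prime p"
  shows "padic_val p (x * y) = padic_val p x + padic_val p y"
proof (cases "x = 0 \<or> y = 0")
  case True
  then show ?thesis
    by (auto simp: padic_val_def)
next
  case False
  obtain a b where x: "x = of_int a / of_int b" "b \<noteq> 0"
    by (rule rat_eq_divide_of_int)
  obtain a' b' where y: "y = of_int a' / of_int b'" "b' \<noteq> 0"
    by (rule rat_eq_divide_of_int)
  have nz: "a \<noteq> 0" "a' \<noteq> 0"
    using False x y by auto
  have "x * y = of_int (a * a') / of_int (b * b')"
    by (simp add: x y)
  moreover have "prime_elem (int p)"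
    using assms by simp
  ultimately show ?thesis
    using assms nz x y
    by (simp del: of_int_mult add: padic_val_divide_of_int prime_elem_multiplicity_mult_distrib)
qed

lemma padic_val_one [simp]: "prime p \<Longrightarrow> padic_val p 1 = 0"
  using padic_val_divide_of_int[of p 1 1] by (simp add: zero_ereal_def)

lemma padic_val_power:
  assumes "prime p" "padic_val p x = 0"
  shows "padic_val p (x ^ n) = 0"
  using assms by (induction n) (auto simp: padic_val_mult)

lemma padic_val_uminus:
  assumes "prime p"
  shows "padic_val p (- x) = padic_val p x"
proof (cases "x = 0")
  case False
  obtain a b where x: "x = of_int a / of_int b" "b \<noteq> 0"
    by (rule rat_eq_divide_of_int)
  then have "- x = of_int (- a) / of_int b" "a \<noteq> 0"
    using False by auto
  then show ?thesis
    using assms x padic_val_divide_of_int[of p a b] padic_val_divide_of_int[of p "- a" b] by simp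
qed simp

text \<open>Over a common denominator the claim concerns numerators: a power of \<open>p\<close>
  dividing both also divides their sum.\<close>

lemma padic_val_add_ge:
  assumes "prime p"
  shows "min (padic_val p x) (padic_val p y) \<le> padic_val p (x + y)"
proof (cases "x = 0 \<or> y = 0 \<or> x + y = 0")
  case True
  then show ?thesis
    by auto
next
  case False
  obtain a b where x: "x = of_int a / of_int b" "b \<noteq> 0"
    by (rule rat_eq_divide_of_int)
  obtain a' b' where y: "y = of_int a' / of_int b'" "b' \<noteq> 0"
    by (rule rat_eq_divide_of_int)
  define k where "k = b * b'"
  have xk: "x = of_int (a * b') / of_int k" and yk: "y = of_int (a' * b) / of_int k"
    using x y by (simp_all add: k_def)
  define n where "n = a * b'"
  define n' where "n' = a' * b"
  have x': "x = of_int n / of_int k" and y': "y = of_int n' / of_int k"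
    and xy: "x + y = of_int (n + n') / of_int k" and k: "k \<noteq> 0"
    using xk yk x y by (simp_all add: n_def n'_def add_divide_distrib k_def)
  have nz: "n \<noteq> 0" "n' \<noteq> 0" "n + n' \<noteq> 0"
    using False x' y' xy by auto
  define l where "l = min (multiplicity (int p) n) (multiplicity (int p) n')"
  have "int p ^ l dvd n + n'"
    by (intro dvd_add) (simp_all add: l_def multiplicity_dvd')
  then have "l \<le> multiplicity (int p) (n + n')"
    using assms nz by (intro multiplicity_geI) (auto simp: prime_nat_iff)
  moreover have "padic_val p x = ereal (real (multiplicity (int p) n) - real (multiplicity (int p) k))"
    "padic_val p y = ereal (real (multiplicity (int p) n') - real (multiplicity (int p) k))"
    "padic_val p (x + y) =
       ereal (real (multiplicity (int p) (n + n')) - real (multiplicity (int p) k))"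
    unfolding xy unfolding x' y' by (rule padic_val_divide_of_int; use assms nz k in simp)+
  ultimately show ?thesis
    by (auto simp: l_def min_def split: if_splits)
qed

lemma padic_val_sum_ge:
  assumes "prime p" "\<And>i. i \<in> I \<Longrightarrow> c \<le> padic_val p (F i)"
  shows "c \<le> padic_val p (\<Sum>i\<in>I. F i)"
  using assms(2)
proof (induction I rule: infinite_finite_induct)
  case (insert i I)
  then have "c \<le> min (padic_val p (F i)) (padic_val p (\<Sum>i\<in>I. F i))"
    by simp
  also have "\<dots> \<le> padic_val p (F i + (\<Sum>i\<in>I. F i))"
    by (rule padic_val_add_ge[OF assms(1)])
  finally show ?case
    using insert by simp
qed auto

text \<open>The bound is a finite real because an empty sum has valuation \<infinity>, which must
  exceed it strictly.\<close>

lemma padic_val_sum_gt: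
  assumes "prime p" "\<And>i. i \<in> I \<Longrightarrow> ereal c < padic_val p (F i)"
  shows "ereal c < padic_val p (\<Sum>i\<in>I. F i)"
  using assms(2)
proof (induction I rule: infinite_finite_induct)
  case (insert i I)
  then have "ereal c < min (padic_val p (F i)) (padic_val p (\<Sum>i\<in>I. F i))"
    by simp
  also have "\<dots> \<le> padic_val p (F i + (\<Sum>i\<in>I. F i))"
    by (rule padic_val_add_ge[OF assms(1)])
  finally show ?case
    using insert by simp
qed auto

text \<open>Since \<open>x = (x + y) + (- y)\<close>, a valuation of \<open>x + y\<close> above that
  of \<open>x\<close> would contradict the ultrametric inequality.\<close>

lemma padic_val_add_eq:
  assumes "prime p" "padic_val p x < padic_val p y"
  shows "padic_val p (x + y) = padic_val p x"
proof (rule antisym)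
  have "min (padic_val p (x + y)) (padic_val p (- y)) \<le> padic_val p (x + y + - y)"
    by (rule padic_val_add_ge[OF assms(1)])
  then show "padic_val p (x + y) \<le> padic_val p x"
    using assms by (auto simp: padic_val_uminus min_def split: if_splits)
  show "padic_val p x \<le> padic_val p (x + y)"
    using padic_val_add_ge[OF assms(1), of x y] assms(2) by (simp add: min_absorb1)
qed

section \<open>Valuation bounds for coefficients of products, powers and compositions\<close>

lemma padic_val_coeff_mult_ge:
  assumes "prime p"
    and "\<And>i. ereal (c * (real n - real i)) \<le> padic_val p (coeff f i)"
    and "\<And>i. ereal (c * (real n' - real i)) \<le> padic_val p (coeff g i)"
  shows "ereal (c * (real (n + n') - real i)) \<le> padic_val p (coeff (f * g) i)"
  unfolding coeff_mult
proof (rule padic_val_sum_ge[OF assms(1)])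
  fix j assume "j \<in> {..i}"
  \<comment> \<open>The weight \<open>c * (n - i)\<close> is additive in \<open>n\<close> and
    \<open>i\<close>, so each term of the convolution inherits the sum of the two bounds.\<close>
  then have "ereal (c * (real (n + n') - real i)) =
      ereal (c * (real n - real j)) + ereal (c * (real n' - real (i - j)))"
    by (simp add: of_nat_diff algebra_simps)
  also have "\<dots> \<le> padic_val p (coeff f j) + padic_val p (coeff g (i - j))"
    by (intro add_mono assms)
  finally show "ereal (c * (real (n + n') - real i)) \<le> padic_val p (coeff f j * coeff g (i - j))"
    by (simp add: padic_val_mult assms(1))
qed

lemma padic_val_coeff_power_ge:
  assumes "prime p" "c \<ge> 0"
    and "\<And>i. ereal (c * (real n - real i)) \<le> padic_val p (coeff f i)"
  shows "ereal (c * (real (n * j) - real i)) \<le> padic_val p (coeff (f ^ j) i)"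
proof (induction j arbitrary: i)
  case 0
  show ?case
    using assms by (cases i) (auto simp: zero_ereal_def)
next
  case (Suc j)
  show ?case
    using padic_val_coeff_mult_ge[OF assms(1,3) Suc, of i] by simp
qed

lemma coeff_pcompose_sum:
  fixes g f :: "'a :: comm_semiring_1 poly"
  shows "coeff (pcompose g f) k = (\<Sum>j\<le>degree g. coeff g j * coeff (f ^ j) k)"
  by (simp add: pcompose_altdef poly_altdef coeff_sum coeff_map_poly degree_map_poly)

section \<open>Lower boundaries of planar convex hulls\<close>

text \<open>This isolates the geometric content of \<open>newton_polygon\<close>, so that the
  convexity arguments need not mention polynomials.\<close>

definition lower_boundary :: "(real \<times> real) set \<Rightarrow> (real \<times> real) set" where
  "lower_boundary S = {(x, y). (x, y) \<in> S \<and> (\<forall>y'. (x, y') \<in> S \<longrightarrow> y \<le> y')}"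

lemma lower_boundary_unique:
  "(x, y) \<in> lower_boundary S \<Longrightarrow> (x, y') \<in> lower_boundary S \<Longrightarrow> y = y'"
  by (force simp: lower_boundary_def)

definition supporting_line :: "(real \<times> real) set \<Rightarrow> real \<times> real \<Rightarrow> real \<Rightarrow> bool" where
  "supporting_line A P s \<longleftrightarrow> (\<forall>R\<in>A. snd P + s * (fst R - fst P) \<le> snd R)"

text \<open>The closed half-plane above the line, written with normal vector \<open>(s, -1)\<close>,
  is convex, so it contains the hull once it contains \<open>A\<close>.\<close>

lemma supporting_line_hull:
  assumes "supporting_line A P s" "R \<in> convex hull A"
  shows "snd P + s * (fst R - fst P) \<le> snd R"
proof -
  let ?H = "{R. inner (s, -1) R \<le> s * fst P - snd P}"
  have "convex hull A \<subseteq> ?H"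
    using assms(1)
    by (intro hull_minimal convex_halfspace_le)
       (auto simp: supporting_line_def inner_prod_def algebra_simps)
  then show ?thesis
    using assms(2) by (auto simp: inner_prod_def algebra_simps)
qed

lemma on_segment:
  fixes P Q :: "real \<times> real"
  assumes "convex S" "P \<in> S" "Q \<in> S" "fst P < fst Q" "x \<in> {fst P..fst Q}"
    and "snd Q = snd P + s * (fst Q - fst P)"
  shows "(x, snd P + s * (x - fst P)) \<in> S"
proof -
  define w where "w = (x - fst P) / (fst Q - fst P)"
  have w: "0 \<le> w" "w \<le> 1" "w * (fst Q - fst P) = x - fst P"
    using assms by (auto simp: w_def field_simps)
  have "(1 - w) *\<^sub>R P + w *\<^sub>R Q \<in> S"
    using assms w by (intro convexD) auto
  moreover have "(1 - w) *\<^sub>R P + w *\<^sub>R Q = (x, snd P + s * (x - fst P))"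
  proof (rule prod_eqI)
    show "fst ((1 - w) *\<^sub>R P + w *\<^sub>R Q) = fst (x, snd P + s * (x - fst P))"
      using w(3) by (simp add: algebra_simps)
    have "snd ((1 - w) *\<^sub>R P + w *\<^sub>R Q) = snd P + s * (w * (fst Q - fst P))"
      by (simp add: assms(6) algebra_simps)
    then show "snd ((1 - w) *\<^sub>R P + w *\<^sub>R Q) = snd (x, snd P + s * (x - fst P))"
      by (simp add: w(3))
  qed
  ultimately show ?thesis
    by simp
qed

section \<open>Edges and slope changes on lower boundaries\<close>

lemma segment_lower_boundary:
  assumes "P \<in> convex hull A" "Q \<in> convex hull A" "fst P < fst Q"
    and "snd Q = snd P + s * (fst Q - fst P)" "supporting_line A P s"
    and "x \<in> {fst P..fst Q}"
  shows "(x, snd P + s * (x - fst P)) \<in> lower_boundary (convex hull A)"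
  \<comment> \<open>Convexity puts the chord into the hull, and the supporting line excludes lower
    points over the same abscissa.\<close>
  using on_segment[OF convex_convex_hull assms(1-3,6,4)] supporting_line_hull[OF assms(5)]
  by (fastforce simp: lower_boundary_def)

text \<open>Gift wrapping: among the points to the right of \<open>P\<close>, take the least slope
  seen from \<open>P\<close>, then the farthest point \<open>Q\<close> attaining it. Minimality
  gives support on the right, and the choice of the farthest point makes it strict beyond
  \<open>Q\<close>.\<close>

lemma maximal_edge_right:
  assumes "finite A" "P \<in> lower_boundary (convex hull A)" "R0 \<in> A" "fst P < fst R0"
  obtains Q s where "Q \<in> A" "fst P < fst Q" "snd Q = snd P + s * (fst Q - fst P)"
    "supporting_line A P s"
    "\<And>R. R \<in> A \<Longrightarrow> fst Q < fst R \<Longrightarrow> snd P + s * (fst R - fst P) < snd R"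
proof -
  define slope where "slope R = (snd R - snd P) / (fst R - fst P)" for R
  define A1 where "A1 = {R \<in> A. fst P < fst R}"
  define s where "s = Min (slope ` A1)"
  define A2 where "A2 = {R \<in> A1. slope R = s}"
  have fin: "finite A1" "A1 \<noteq> {}" "finite A2"
    using assms(1,3,4) unfolding A1_def A2_def by fastforce+
  have "s \<in> slope ` A1"
    unfolding s_def using fin by (intro Min_in) auto
  then have "A2 \<noteq> {}"
    by (auto simp: A2_def)
  then have "Max (fst ` A2) \<in> fst ` A2"
    using fin by (intro Max_in) auto
  then obtain Q where Q: "Q \<in> A2" and QMax: "fst Q = Max (fst ` A2)"
    by auto
  have Qmax: "fst R \<le> fst Q" if "R \<in> A2" for R
    unfolding QMax using that fin by (intro Max_ge) auto
  have QA: "Q \<in> A" "fst P < fst Q" "snd Q = snd P + s * (fst Q - fst P)"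
    using Q by (auto simp: A2_def A1_def slope_def field_simps)
  have right: "snd P + s * (fst R - fst P) \<le> snd R" if "R \<in> A1" for R
  proof -
    have "s \<le> slope R"
      unfolding s_def using that fin by (intro Min_le) auto
    then show ?thesis
      using that by (auto simp: A1_def slope_def field_simps)
  qed
  have "snd P + s * (fst R - fst P) \<le> snd R" if R: "R \<in> A" for R
  proof (cases "fst P < fst R")
    case True
    then show ?thesis
      using right R by (simp add: A1_def)
  next
    \<comment> \<open>\<open>R\<close> is not to the right of \<open>P\<close>, so the chord from
      \<open>R\<close> to \<open>Q\<close> passes over the abscissa of \<open>P\<close>. It cannot
      run below \<open>P\<close>, hence its slope \<open>r\<close> is at most \<open>s\<close>,
      which keeps \<open>R\<close> on or above the line.\<close>
    case False
    define r where "r = (snd Q - snd R) / (fst Q - fst R)"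
    have lt: "fst R < fst Q"
      using False QA by simp
    then have r: "snd Q = snd R + r * (fst Q - fst R)"
      by (simp add: r_def)
    have "(fst P, snd R + r * (fst P - fst R)) \<in> convex hull A"
      using on_segment[OF convex_convex_hull _ _ lt _ r, of A "fst P"] R QA False
      by (auto simp: hull_inc)
    then have le: "snd P \<le> snd R + r * (fst P - fst R)"
      using assms(2) by (auto simp: lower_boundary_def case_prod_beta)
    have "snd R + r * (fst P - fst R) = snd Q - r * (fst Q - fst P)"
      by (simp add: r algebra_simps)
    then have "r * (fst Q - fst P) \<le> s * (fst Q - fst P)"
      using le QA by simp
    then have "r \<le> s"
      using QA by simp
    then have "r * (fst Q - fst R) \<le> s * (fst Q - fst R)"
      using lt by simp
    then have "snd Q - s * (fst Q - fst R) \<le> snd R"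
      using r by simp
    then show ?thesis
      by (simp add: QA algebra_simps)
  qed
  then have sup: "supporting_line A P s"
    by (simp add: supporting_line_def)
  have strict: "snd P + s * (fst R - fst P) < snd R" if "R \<in> A" "fst Q < fst R" for R
  proof -
    have R: "R \<in> A1"
      using that QA by (simp add: A1_def)
    moreover have "R \<notin> A2"
      using Qmax[of R] that by linarith
    ultimately have "snd R \<noteq> snd P + s * (fst R - fst P)"
      by (auto simp: A2_def A1_def slope_def)
    then show ?thesis
      using right[OF R] by simp
  qed
  show thesis
    using that QA sup strict by blast
qed

text \<open>If \<open>Q\<close> lies to the left of \<open>R0\<close>, a further maximal edge starts
  at \<open>Q\<close>. Its right end lies strictly above the line from \<open>P\<close>, so the two
  slopes at \<open>Q\<close> differ.\<close>

lemma maximal_edge_right_vertex: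
  assumes "finite A" "P \<in> lower_boundary (convex hull A)" "R0 \<in> A" "fst P < fst R0"
  obtains Q s where "Q \<in> A" "fst P < fst Q" "snd Q = snd P + s * (fst Q - fst P)"
    "supporting_line A P s"
    "Q \<in> lower_boundary (convex hull A)"
    "fst Q < fst R0 \<Longrightarrow> slope_changes_at (lower_boundary (convex hull A)) Q"
proof -
  obtain Q s where Q: "Q \<in> A" "fst P < fst Q" "snd Q = snd P + s * (fst Q - fst P)"
    "supporting_line A P s"
    and strict: "\<And>R. R \<in> A \<Longrightarrow> fst Q < fst R \<Longrightarrow> snd P + s * (fst R - fst P) < snd R"
    using maximal_edge_right[OF assms] by metis
  let ?L = "lower_boundary (convex hull A)"
  have hull: "P \<in> convex hull A" "Q \<in> convex hull A"
    using assms(2) Q by (auto simp: lower_boundary_def hull_inc)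
  note left = segment_lower_boundary[OF hull Q(2,3,4)]
  have QL: "Q \<in> ?L"
    using left[of "fst Q"] Q by (metis atLeastAtMost_iff less_imp_le order_refl prod.collapse)
  have "slope_changes_at ?L Q" if less: "fst Q < fst R0"
  proof -
    obtain Q' s' where Q': "Q' \<in> A" "fst Q < fst Q'" "snd Q' = snd Q + s' * (fst Q' - fst Q)"
      "supporting_line A Q s'"
      using maximal_edge_right[OF assms(1) QL assms(3) less] by metis
    note right = segment_lower_boundary[OF hull(2) hull_inc[OF Q'(1)] Q'(2,3,4)]
    have "s \<noteq> s'"
      using strict[OF Q'(1,2)] Q(3) Q'(3) by (auto simp: algebra_simps)
    \<comment> \<open>The smaller of the two edge widths keeps both displacements inside their
      edges.\<close>
    moreover define \<delta> where "\<delta> = min (fst Q - fst P) (fst Q' - fst Q)"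
    moreover have "\<delta> > 0"
      using Q Q' by (simp add: \<delta>_def)
    moreover have "(fst Q - r, snd Q - s * r) \<in> ?L \<and> (fst Q + r, snd Q + s' * r) \<in> ?L"
      if "r \<in> {0..\<delta>}" for r
    proof
      have "(fst Q - r, snd P + s * (fst Q - r - fst P)) \<in> ?L"
        using that by (intro left) (auto simp: \<delta>_def)
      also have "snd P + s * (fst Q - r - fst P) = snd Q - s * r"
        by (simp add: Q(3) algebra_simps)
      finally show "(fst Q - r, snd Q - s * r) \<in> ?L" .
      show "(fst Q + r, snd Q + s' * r) \<in> ?L"
        using right[of "fst Q + r"] that by (auto simp: \<delta>_def)
    qed
    ultimately show ?thesis
      unfolding slope_changes_at_def by blast
  qed
  then show thesis
    using that Q QL by blast
qed

text \<open>The lower boundary has at most one point over each abscissa, so near \<open>R\<close> it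
  coincides with the segment and both one-sided slopes equal \<open>s\<close>.\<close>

lemma no_slope_change_on_segment:
  assumes seg: "\<And>x. x \<in> {a..b} \<Longrightarrow> (x, c + s * x) \<in> lower_boundary S"
    and R: "R \<in> lower_boundary S" "fst R \<in> {a<..<b}"
  shows "\<not> slope_changes_at (lower_boundary S) R"
proof
  assume "slope_changes_at (lower_boundary S) R"
  then obtain k k' \<delta> where k: "k \<noteq> k'" "\<delta> > 0"
    "\<And>r. r \<in> {0..\<delta>} \<Longrightarrow> (fst R - r, snd R - k * r) \<in> lower_boundary S"
    "\<And>r. r \<in> {0..\<delta>} \<Longrightarrow> (fst R + r, snd R + k' * r) \<in> lower_boundary S"
    unfolding slope_changes_at_def by blast
  define r where "r = min \<delta> (min (fst R - a) (b - fst R))"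
  have r: "r > 0" "r \<in> {0..\<delta>}" "fst R - r \<in> {a..b}" "fst R + r \<in> {a..b}" "fst R \<in> {a..b}"
    using R(2) k(2) by (auto simp: r_def)
  have "snd R = c + s * fst R"
    by (rule lower_boundary_unique[of "fst R" _ S]) (use R seg r in auto)
  moreover have "snd R - k * r = c + s * (fst R - r)"
    by (rule lower_boundary_unique[OF k(3) seg]) (use r in auto)
  moreover have "snd R + k' * r = c + s * (fst R + r)"
    by (rule lower_boundary_unique[OF k(4) seg]) (use r in auto)
  ultimately have "k * r = s * r" "k' * r = s * r"
    by (auto simp: algebra_simps)
  then show False
    using k(1) r(1) by simp
qed

text \<open>The vertices are known only as endpoints and slope changes. The maximal edge starting at
  \<open>v i\<close> ends at some \<open>v k\<close>, and \<open>k > Suc i\<close> would put the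
  slope change \<open>v (Suc i)\<close> inside a straight segment; so consecutive vertices span an
  edge.\<close>

lemma successive_vertices_supporting_line:
  fixes v :: "nat \<Rightarrow> real \<times> real"
  assumes fin: "finite A"
    and A: "v t \<in> A"
    and mono: "\<And>i j. i < j \<Longrightarrow> j \<le> t \<Longrightarrow> fst (v i) < fst (v j)"
    and vs: "v ` {..t} = {P \<in> lower_boundary (convex hull A). fst P = fst (v 0) \<or> fst P = fst (v t) \<or>
               slope_changes_at (lower_boundary (convex hull A)) P}"
    and bound: "\<And>P. P \<in> A \<Longrightarrow> fst P \<le> fst (v t)"
    and i: "i < t"
    and s: "s = (snd (v (Suc i)) - snd (v i)) / (fst (v (Suc i)) - fst (v i))"
  shows "supporting_line A (v i) s"
proof -
  let ?L = "lower_boundary (convex hull A)"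
  have vL: "v j \<in> ?L" if "j \<le> t" for j
    using vs that by blast
  obtain Q r where Q: "Q \<in> A" "fst (v i) < fst Q" "snd Q = snd (v i) + r * (fst Q - fst (v i))"
    "supporting_line A (v i) r" "Q \<in> ?L" "fst Q < fst (v t) \<Longrightarrow> slope_changes_at ?L Q"
    using maximal_edge_right_vertex[OF fin vL A mono] i by (metis less_imp_le order_refl)
  \<comment> \<open>Either \<open>Q\<close> is at the right end, or it is strictly before it and the
    slope changes there.\<close>
  have "Q \<in> v ` {..t}"
    unfolding vs using Q bound[OF Q(1)] by force
  then obtain k where k: "k \<le> t" "Q = v k"
    by auto
  have "i < k"
  proof (rule ccontr)
    assume "\<not> i < k"
    then have "fst (v k) \<le> fst (v i)"
      using mono[of k i] i by (cases "k = i") auto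
    then show False
      using Q k by simp
  qed
  have "k = Suc i"
  proof (rule ccontr)
    assume "k \<noteq> Suc i"
    then have lt: "Suc i < k"
      using \<open>i < k\<close> by simp
    have f: "fst (v i) < fst (v (Suc i))" "fst (v (Suc i)) < fst Q" "fst (v 0) < fst (v (Suc i))"
       "fst (v (Suc i)) < fst (v t)"
      using lt k i by (auto intro: mono)
    have "v (Suc i) \<in> v ` {..t}"
      using i by auto
    then have "slope_changes_at ?L (v (Suc i))"
      using f unfolding vs by auto
    moreover have "(x, (snd (v i) - r * fst (v i)) + r * x) \<in> ?L" if "x \<in> {fst (v i)..fst Q}" for x
      using segment_lower_boundary[OF _ hull_inc[OF Q(1)] Q(2,3,4) that] vL[of i] i
      by (auto simp: lower_boundary_def algebra_simps)
    then have "\<not> slope_changes_at ?L (v (Suc i))"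
      by (rule no_slope_change_on_segment[where a = "fst (v i)" and b = "fst Q"])
         (use vL i f in auto)
    ultimately show False
      by blast
  qed
  then have "r = s"
    using s Q k by auto
  then show ?thesis
    using Q by simp
qed

lemma increasing_interval:
  fixes a :: "nat \<Rightarrow> real"
  assumes "0 < t" "a 0 \<le> x" "x \<le> a t"
  obtains i where "i < t" "a i \<le> x" "x \<le> a (Suc i)"
proof -
  have "\<exists>i<t. a i \<le> x \<and> x \<le> a (Suc i)"
    using assms
  proof (induction t)
    case (Suc t)
    show ?case
    proof (cases "t > 0 \<and> x \<le> a t")
      case True
      then show ?thesis
        using Suc less_SucI by blast
    next
      case False
      then show ?thesis
        using Suc.prems by (cases "t = 0") auto
    qed
  qed auto
  then show thesis
    using that by blast
qed

section \<open>Stretching in the horizontal direction\<close>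

lemma slope_changes_at_scale_imp:
  assumes "c > 0" "slope_changes_at L P"
  shows "slope_changes_at ((\<lambda>(x, y). (c * x, y)) ` L) (c * fst P, snd P)"
proof -
  obtain s s' \<delta> where *: "s \<noteq> s'" "\<delta> > 0"
    "\<And>r. r \<in> {0..\<delta>} \<Longrightarrow> (fst P - r, snd P - s * r) \<in> L"
    "\<And>r. r \<in> {0..\<delta>} \<Longrightarrow> (fst P + r, snd P + s' * r) \<in> L"
    using assms(2) unfolding slope_changes_at_def by blast
  show ?thesis
    unfolding slope_changes_at_def
  proof (intro exI conjI ballI)
    \<comment> \<open>Stretching by \<open>c\<close> divides slopes by \<open>c\<close> and
      multiplies widths by \<open>c\<close>.\<close>
    show "s / c \<noteq> s' / c" "c * \<delta> > 0"
      using * assms(1) by auto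
    fix r assume "r \<in> {0..c * \<delta>}"
    then have r: "r / c \<in> {0..\<delta>}"
      using assms(1) by (auto simp: field_simps)
    show "(fst (c * fst P, snd P) - r, snd (c * fst P, snd P) - s / c * r)
        \<in> (\<lambda>(x, y). (c * x, y)) ` L"
      using *(3)[OF r] assms(1) by (force simp: field_simps image_iff)
    show "(fst (c * fst P, snd P) + r, snd (c * fst P, snd P) + s' / c * r)
        \<in> (\<lambda>(x, y). (c * x, y)) ` L"
      using *(4)[OF r] assms(1) by (force simp: field_simps image_iff)
  qed
qed

text \<open>The converse is the one-sided implication for the inverse factor, applied to the
  stretched set.\<close>

lemma slope_changes_at_scale:
  assumes "c > 0"
  shows "slope_changes_at ((\<lambda>(x, y). (c * x, y)) ` L) (c * x, y) \<longleftrightarrow> slope_changes_at L (x, y)"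
proof
  assume "slope_changes_at ((\<lambda>(x, y). (c * x, y)) ` L) (c * x, y)"
  then have "slope_changes_at ((\<lambda>(x, y). (inverse c * x, y)) ` (\<lambda>(x, y). (c * x, y)) ` L)
      (inverse c * fst (c * x, y), snd (c * x, y))"
    by (rule slope_changes_at_scale_imp[rotated]) (use assms in simp)
  moreover have "(\<lambda>(x, y). (inverse c * x, y)) ` (\<lambda>(x, y). (c * x, y)) ` L = L"
    using assms by (simp add: image_image case_prod_beta mult.assoc[symmetric])
  ultimately show "slope_changes_at L (x, y)"
    using assms by (simp add: mult.assoc[symmetric])
next
  show "slope_changes_at L (x, y) \<Longrightarrow> slope_changes_at ((\<lambda>(x, y). (c * x, y)) ` L) (c * x, y)"
    using slope_changes_at_scale_imp[OF assms, of L "(x, y)"] by simp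
qed

text \<open>A criterion that compares \<open>A\<close> and \<open>B\<close> without matching their
  points one by one. \<open>V\<close> stands for the vertices of \<open>A\<close>: their stretched
  images lie in \<open>B\<close> and bound its boundary from above, while the last hypothesis bounds
  it from below.\<close>

lemma lower_boundary_scale:
  fixes A B :: "(real \<times> real) set"
  assumes "c > 0"
    and V: "\<And>P. P \<in> V \<Longrightarrow> (c * fst P, snd P) \<in> B"
    and low: "\<And>x y. (x, y) \<in> convex hull A \<Longrightarrow>
           \<exists>y'\<le>y. (x, y') \<in> convex hull V \<and> (x, y') \<in> lower_boundary (convex hull A)"
    and B: "\<And>P. P \<in> B \<Longrightarrow> \<exists>y\<le>snd P. (fst P / c, y) \<in> convex hull A"
  shows "lower_boundary (convex hull B) = (\<lambda>(x, y). (c * x, y)) ` lower_boundary (convex hull A)"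
proof -
  let ?T = "\<lambda>P::real \<times> real. (c * fst P, snd P)"
  have lin: "linear ?T"
    by (intro linearI) (auto simp: algebra_simps)
  have "?T ` (convex hull V) = convex hull (?T ` V)"
    by (rule convex_hull_linear_image[OF lin])
  also have "\<dots> \<subseteq> convex hull B"
    using V by (intro hull_mono) auto
  finally have VB: "?T ` (convex hull V) \<subseteq> convex hull B" .
  have up: "\<exists>y\<le>snd P. (fst P / c, y) \<in> convex hull A" if "P \<in> convex hull B" for P
  proof -
    \<comment> \<open>The points on or above the stretched hull of \<open>A\<close> form a convex
      set containing \<open>B\<close>, hence containing its hull.\<close>
    let ?U = "{P. \<exists>y\<le>snd P. (fst P / c, y) \<in> convex hull A}"
    have "convex ?U"
    proof (rule convexI)
      fix P Q :: "real \<times> real" and a b :: real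
      assume "P \<in> ?U" "Q \<in> ?U" and ab: "0 \<le> a" "0 \<le> b" "a + b = 1"
      then obtain y z where yz: "y \<le> snd P" "(fst P / c, y) \<in> convex hull A"
        "z \<le> snd Q" "(fst Q / c, z) \<in> convex hull A"
        by blast
      have "a *\<^sub>R (fst P / c, y) + b *\<^sub>R (fst Q / c, z) \<in> convex hull A"
        using yz ab by (intro convexD) auto
      then show "a *\<^sub>R P + b *\<^sub>R Q \<in> ?U"
        using yz ab by (auto simp: add_divide_distrib intro!: exI[of _ "a * y + b * z"] add_mono mult_left_mono)
    qed
    then have "convex hull B \<subseteq> ?U"
      using B by (intro hull_minimal) auto
    then show ?thesis
      using that by blast
  qed
  show ?thesis
  proof (intro equalityI subsetI)
    fix P assume P: "P \<in> lower_boundary (convex hull B)"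
    then have "P \<in> convex hull B"
      by (auto simp: lower_boundary_def)
    then obtain y where y: "y \<le> snd P" "(fst P / c, y) \<in> convex hull A"
      using up by blast
    then obtain y' where y': "y' \<le> y" "(fst P / c, y') \<in> convex hull V"
      "(fst P / c, y') \<in> lower_boundary (convex hull A)"
      using low by blast
    have "(fst P, y') \<in> convex hull B"
      using VB y'(2) assms(1) by (force simp: image_subset_iff)
    then have "snd P \<le> y'"
      using P by (auto simp: lower_boundary_def)
    then have "y' = snd P"
      using y y' by simp
    then show "P \<in> (\<lambda>(x, y). (c * x, y)) ` lower_boundary (convex hull A)"
      using y'(3) assms(1) by (intro image_eqI[of _ _ "(fst P / c, y')"]) auto
  next
    fix P assume "P \<in> (\<lambda>(x, y). (c * x, y)) ` lower_boundary (convex hull A)"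
    then obtain x y where P: "P = (c * x, y)" and xy: "(x, y) \<in> lower_boundary (convex hull A)"
      by auto
    then have "(x, y) \<in> convex hull A"
      by (auto simp: lower_boundary_def)
    then obtain y' where "(x, y') \<in> convex hull V" "(x, y') \<in> lower_boundary (convex hull A)"
      using low by blast
    then have "(x, y) \<in> convex hull V"
      using lower_boundary_unique xy by blast
    then have "P \<in> convex hull B"
      using VB P by (force simp: image_subset_iff)
    moreover have "y \<le> z" if z: "(c * x, z) \<in> convex hull B" for z
    proof -
      obtain w where "w \<le> z" "(x, w) \<in> convex hull A"
        using up[OF z] assms(1) by auto
      then show ?thesis
        using xy by (force simp: lower_boundary_def)
    qed
    ultimately show "P \<in> lower_boundary (convex hull B)"
      by (auto simp: lower_boundary_def P)
  qed
qed

section \<open>Newton polygons of compositions\<close>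

lemma newton_polygon_eq_lower_boundary:
  "newton_polygon p h = lower_boundary (convex hull newton_points p h)"
  by (simp add: newton_polygon_def lower_boundary_def)

lemma finite_newton_points: "finite (newton_points p h)"
proof (rule finite_subset)
  \<comment> \<open>\<open>real_of_ereal\<close> sends the infinite valuation of a zero coefficient
    to 0; the image may thus contain extra points, which is harmless for finiteness.\<close>
  show "newton_points p h \<subseteq>
      (\<lambda>i. (real (degree h - i), real_of_ereal (padic_val p (coeff h i)))) ` {..degree h}"
    by (force simp: newton_points_def)
qed simp

lemma newton_vertices_scale:
  assumes "newton_polygon p h = (\<lambda>(x, y). (real d * x, y)) ` newton_polygon p g"
    and "degree h = d * degree g" "d > 0"
  shows "newton_vertices p h = (\<lambda>(x, y). (real d * x, y)) ` newton_vertices p g"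
proof -
  have "(real d * x, y) \<in> newton_vertices p h \<longleftrightarrow> (x, y) \<in> newton_vertices p g"
    if "(x, y) \<in> newton_polygon p g" for x y
  proof -
    have "(real d * x, y) \<in> newton_polygon p h"
      using that assms(1) by force
    then show ?thesis
      using that assms(2,3) slope_changes_at_scale[of "real d" "newton_polygon p g" x y]
      unfolding newton_vertices_def by (simp add: assms(1))
  qed
  moreover have "newton_vertices p h \<subseteq> (\<lambda>(x, y). (real d * x, y)) ` newton_polygon p g"
    using assms(1) by (auto simp: newton_vertices_def)
  moreover have "newton_vertices p g \<subseteq> newton_polygon p g"
    by (auto simp: newton_vertices_def)
  ultimately show ?thesis
    by fast
qed

text \<open>Vertices have real coordinates, so being listed forces \<open>w i\<close> to be finite.
  This allows real arithmetic with the valuations at the vertices.\<close>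

lemma successive_newton_verticesD:
  assumes "successive_newton_vertices p g (map (\<lambda>i. (a i, w i)) [0..<Suc t])"
  shows "\<And>i. i \<le> t \<Longrightarrow> w i = ereal (real_of_ereal (w i))"
    and "\<And>i j. i < j \<Longrightarrow> j \<le> t \<Longrightarrow> a i < a j"
    and "(\<lambda>i. (a i, real_of_ereal (w i))) ` {..t} = newton_vertices p g"
proof -
  have eq: "(\<lambda>i. (a i, w i)) ` {..t} = (\<lambda>(x, y). (x, ereal y)) ` newton_vertices p g"
    using assms by (simp add: successive_newton_vertices_def atLeast0LessThan lessThan_Suc_atMost
        del: upt_Suc)
  show w: "w i = ereal (real_of_ereal (w i))" if "i \<le> t" for i
  proof -
    have "(a i, w i) \<in> (\<lambda>(x, y). (x, ereal y)) ` newton_vertices p g"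
      unfolding eq[symmetric] using that by auto
    then show ?thesis
      by auto
  qed
  show "a i < a j" if "i < j" "j \<le> t" for i j
    using assms that
    by (auto simp: successive_newton_vertices_def sorted_wrt_iff_nth_less simp del: upt_Suc)
  have "(\<lambda>(x, y). (x, real_of_ereal y)) ` (\<lambda>i. (a i, w i)) ` {..t} =
      (\<lambda>(x, y). (x, real_of_ereal y)) ` (\<lambda>(x, y). (x, ereal y)) ` newton_vertices p g"
    by (simp only: eq)
  then show "(\<lambda>i. (a i, real_of_ereal (w i))) ` {..t} = newton_vertices p g"
    by (simp add: image_image case_prod_beta)
qed

lemma coeff_power_top:
  fixes f :: "'a :: idom poly"
  shows "coeff (f ^ j) (degree f * j) = lead_coeff f ^ j"
  by (cases "f = 0") (auto simp: degree_power_eq mult.commute lead_coeff_power[symmetric] power_0_left)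

theorem theorem1p6:
  fixes p e d t \<beta> :: nat
    and u :: int
    and f g :: "rat poly"
    and m :: "nat \<Rightarrow> nat"
    and lam :: "nat \<Rightarrow> ereal"
  assumes "prime p"
    and "degree g = e"
    and "coeff g 0 \<noteq> 0"
    and "m 0 = e"
    and "m t = 0"
    and "successive_newton_vertices p g
           (map (\<lambda>i. (real e - real (m i), padic_val p (coeff g (m i)))) [0..<Suc t])"
    and "\<And>i. 1 \<le> i \<Longrightarrow> i \<le> t \<Longrightarrow>
           lam i = (padic_val p (coeff g (m i)) - padic_val p (coeff g (m (i - 1))))
                   / ereal (real (m (i - 1)) - real (m i))"
    and "\<And>j. 1 \<le> j \<Longrightarrow> j \<le> t \<Longrightarrow> ereal (real_of_int u) > \<bar>lam j\<bar>"
    and "degree f = d"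
    and "padic_val p (coeff f d) = 0"
    and "0 < \<beta>"
    and "\<beta> \<le> d"
    and "coprime (int \<beta>) u"
    and "\<And>i. i \<le> d \<Longrightarrow>
           padic_val p (coeff f i) \<ge> ereal (real_of_int u / real \<beta> * (real d - real i))"
  shows "successive_newton_vertices p (pcompose g f)
           (map (\<lambda>i. (real d * (real e - real (m i)), padic_val p (coeff g (m i)))) [0..<Suc t])"
proof (cases "e = 0")
  case True
  \<comment> \<open>The abscissas increase strictly, but the first and the last are both 0 here, so
    there is a single vertex. As \<open>g\<close> is constant, composition leaves it
    unchanged.\<close>
  have "t = 0"
    using successive_newton_verticesD(2)[OF assms(6), of 0 t] assms(4,5) True by (cases t) auto
  moreover obtain c where "g = [:c:]"
    using assms(2) True degree_eq_zeroE by blast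
  ultimately show ?thesis
    using assms(4,6) True by simp
next
  case False
  then have t: "t > 0"
    using assms(4,5) by (cases t) auto
  have d: "d > 0"
    using assms(11,12) by simp
  define h where "h = pcompose g f"
  define A where "A = newton_points p g"
  define y where "y i = real_of_ereal (padic_val p (coeff g (m i)))" for i
  define v where "v i = (real e - real (m i), y i)" for i
  define s where "s i = (snd (v (Suc i)) - snd (v i)) / (fst (v (Suc i)) - fst (v i))" for i
  \<comment> \<open>\<open>line i\<close> extends the edge from \<open>v i\<close> to
    \<open>v (Suc i)\<close>, in the coordinates of \<open>g\<close>. Points of \<open>h\<close> are
    compared with it after dividing abscissas by \<open>d\<close>.\<close>
  define line where "line i x = snd (v i) + s i * (x - fst (v i))" for i x
  note D = successive_newton_verticesD[OF assms(6)]
  have w: "padic_val p (coeff g (m i)) = ereal (y i)" if "i \<le> t" for i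
    using D(1)[OF that] by (simp add: y_def)
  have mono: "fst (v i) < fst (v j)" if "i < j" "j \<le> t" for i j
    using D(2)[OF that] by (simp add: v_def)
  have vs: "v ` {..t} = newton_vertices p g"
    using D(3) by (simp add: v_def[abs_def] y_def)
  have v0: "fst (v 0) = 0" and vt: "fst (v t) = real e"
    by (simp_all add: v_def assms)
  have m_le: "m i \<le> e" if "i \<le> t" for i
    using mono[of 0 i] that v0 by (cases "i = 0") (auto simp: v_def assms)
  have vA: "v i \<in> A" if "i \<le> t" for i
    using m_le[OF that] w[OF that]
    unfolding A_def newton_points_def assms(2) v_def by (auto intro!: exI[of _ "m i"])
  have finA: "finite A"
    by (simp add: A_def finite_newton_points)
  have A_fst: "fst P \<in> {0..real e}" if "P \<in> A" for P
    using that by (auto simp: A_def newton_points_def assms(2))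
  have hullA_fst: "fst P \<in> {0..real e}" if "P \<in> convex hull A" for P
  proof -
    have "convex hull A \<subseteq> {0..real e} \<times> UNIV"
      using A_fst by (intro hull_minimal convex_Times) (auto simp: mem_Times_iff)
    then show ?thesis
      using that by auto
  qed

  have sup: "supporting_line A (v i) (s i)" if "i < t" for i
  proof (rule successive_vertices_supporting_line[of A v t i "s i"])
    show "v ` {..t} = {P \<in> lower_boundary (convex hull A). fst P = fst (v 0) \<or> fst P = fst (v t) \<or>
               slope_changes_at (lower_boundary (convex hull A)) P}"
      unfolding vs newton_vertices_def newton_polygon_eq_lower_boundary A_def v0 vt assms(2) ..
  qed (use finA vA mono A_fst vt that vt in \<open>auto simp: s_def\<close>)
  have s_less: "s i < real_of_int u" "\<bar>s i\<bar> < real_of_int u" if "i < t" for i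
  proof -
    \<comment> \<open>Edges are numbered from 0 but \<open>lam\<close> from 1. The denominator
      \<open>m i - m (Suc i)\<close> is the difference of the abscissas, so
      \<open>lam (Suc i)\<close> is the slope of edge \<open>i\<close>.\<close>
    have "lam (Suc i) = ereal (s i)"
      using assms(7)[of "Suc i"] that w[of i] w[of "Suc i"] mono[of i "Suc i"]
      by (simp add: s_def v_def)
    then show "\<bar>s i\<bar> < real_of_int u"
      using assms(8)[of "Suc i"] that by simp
    then show "s i < real_of_int u"
      by simp
  qed
  \<comment> \<open>Since \<open>t > 0\<close> there is an edge, and \<open>u\<close> exceeds the
    absolute value of its slope.\<close>
  have u: "real_of_int u \<ge> 0"
    using s_less(2)[OF t] by simp

  have edge: "snd (v (Suc i)) = snd (v i) + s i * (fst (v (Suc i)) - fst (v i))" if "i < t" for i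
    using mono[of i "Suc i"] that by (simp add: s_def v_def)
  have edge_ex: "\<exists>i<t. x \<in> {fst (v i)..fst (v (Suc i))}" if "x \<in> {0..real e}" for x
    using increasing_interval[OF t, of "\<lambda>i. fst (v i)" x] that v0 vt by (metis atLeastAtMost_iff)

  \<comment> \<open>Valuations of the coefficients of the composition\<close>
  have f_bound: "ereal (real_of_int u / real d * (real d - real i)) \<le> padic_val p (coeff f i)" for i
  proof (cases "i \<le> d")
    case True
    \<comment> \<open>As \<open>u\<close> is nonnegative, enlarging the denominator from \<beta> to
      \<open>d\<close> weakens the bound. With \<open>u / d\<close> the bound for
      \<open>f ^ j\<close> in degree \<open>k\<close> becomes exactly
      \<open>u * (j - k / d)\<close>.\<close>
    have "real_of_int u / real d * (real d - real i) \<le> real_of_int u / real \<beta> * (real d - real i)"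
      using True u assms(11,12) by (intro mult_right_mono divide_left_mono) auto
    then show ?thesis
      using assms(14)[OF True] by (meson ereal_less_eq(3) order_trans)
  next
    case False
    then show ?thesis
      using assms(9) by (simp add: coeff_eq_0)
  qed
  have f_pow: "ereal (real_of_int u / real d * (real (d * j) - real k))
      \<le> padic_val p (coeff (f ^ j) k)" for j k
    using padic_val_coeff_power_ge[OF assms(1) _ f_bound] u by simp

  have summand: "ereal (line i (real e - real k / real d)) \<le> padic_val p (coeff g j * coeff (f ^ j) k) \<and>
      (k \<noteq> d * j \<longrightarrow>
        ereal (line i (real e - real k / real d)) < padic_val p (coeff g j * coeff (f ^ j) k))"
    if i: "i < t" and j: "j \<le> e" for i j k
  proof (cases "coeff g j = 0 \<or> k > d * j")
    case True
    then have zero: "coeff g j * coeff (f ^ j) k = 0"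
      using degree_power_le[of f j] by (auto simp: assms(9) coeff_eq_0)
    show ?thesis
      unfolding zero by simp
  next
    case False
    \<comment> \<open>Since \<open>e - k / d = (e - j) + z\<close>, the line rises by
      \<open>s i * z\<close> between the abscissa of \<open>coeff g j\<close> and that of degree
      \<open>k\<close>, while the power of \<open>f\<close> adds at least \<open>u * z\<close> to
      the valuation.\<close>
    define z where "z = real j - real k / real d"
    have "real k \<le> real (d * j)"
      using False by linarith
    then have z: "z \<ge> 0" "k \<noteq> d * j \<longrightarrow> z > 0"
      using d False by (auto simp: z_def field_simps simp flip: of_nat_mult)
    obtain r where r: "padic_val p (coeff g j) = ereal r"
      using False by (auto simp: padic_val_def)
    then have "(real (e - j), r) \<in> A"
      unfolding A_def newton_points_def assms(2) using j by blast
    then have "line i (real e - real j) \<le> r"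
      using sup[OF i] j by (auto simp: supporting_line_def line_def of_nat_diff)
    moreover have "line i (real e - real k / real d) = line i (real e - real j) + s i * z"
      by (simp add: line_def z_def algebra_simps)
    moreover have "s i * z \<le> real_of_int u * z" "k \<noteq> d * j \<longrightarrow> s i * z < real_of_int u * z"
      using z s_less(1)[OF i] by (auto intro: mult_right_mono)
    ultimately have "line i (real e - real k / real d) \<le> r + real_of_int u * z"
      "k \<noteq> d * j \<longrightarrow> line i (real e - real k / real d) < r + real_of_int u * z"
      by linarith+
    moreover have "ereal (real_of_int u * z) \<le> padic_val p (coeff (f ^ j) k)"
      using f_pow[of j k] d by (simp add: z_def field_simps)
    then have "ereal (r + real_of_int u * z) \<le> padic_val p (coeff g j * coeff (f ^ j) k)"
      using add_left_mono[of "ereal (real_of_int u * z)" _ "ereal r"]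
      by (simp add: padic_val_mult assms(1) r)
    ultimately show ?thesis
      by (meson ereal_less_eq(3) less_ereal.simps(1) less_le_trans order_trans)
  qed
  have h_coeff: "coeff h k = (\<Sum>j\<le>e. coeff g j * coeff (f ^ j) k)" for k
    by (simp add: h_def coeff_pcompose_sum assms(2))
  have h_ge: "ereal (line i (real e - real k / real d)) \<le> padic_val p (coeff h k)" if "i < t" for i k
    unfolding h_coeff using summand[OF that] by (intro padic_val_sum_ge assms(1)) auto

  have h_vertex: "padic_val p (coeff h (d * m i)) = ereal (y i)" if i: "i \<le> t" for i
  proof -
    let ?c = "\<lambda>j. coeff g j * coeff (f ^ j) (d * m i)"
    \<comment> \<open>The vertex must lie on some edge line: that of the edge starting there or, for
      the last vertex, of the edge ending there.\<close>
    obtain i' where i': "i' < t" "line i' (fst (v i)) = y i"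
    proof (cases "i < t")
      case True
      then show ?thesis
        using that[of i] by (simp add: line_def v_def)
    next
      case False
      then show ?thesis
        using that[of "i - 1"] edge[of "i - 1"] i t by (simp add: line_def v_def)
    qed
    have x: "real e - real (d * m i) / real d = fst (v i)"
      using d by (simp add: v_def)
    \<comment> \<open>For \<open>j = m i\<close> the factor from \<open>f ^ j\<close> is its top
      coefficient, a power of the leading coefficient of \<open>f\<close>, which has valuation
      0.\<close>
    have main: "padic_val p (?c (m i)) = ereal (y i)"
      using coeff_power_top[of f "m i"] assms(1,9,10) w[OF i]
      by (simp add: padic_val_mult padic_val_power)
    \<comment> \<open>For the other \<open>j\<close> the degrees \<open>d * j\<close> and
      \<open>d * m i\<close> differ because \<open>d > 0\<close>. All these terms lie strictly above
      the vertex, so the term for \<open>m i\<close> alone determines the valuation.\<close>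
    have "ereal (y i) < padic_val p (\<Sum>j\<in>{..e} - {m i}. ?c j)"
    proof (intro padic_val_sum_gt assms(1))
      fix j assume "j \<in> {..e} - {m i}"
      then have "j \<le> e" "d * m i \<noteq> d * j"
        using d by auto
      then show "ereal (y i) < padic_val p (?c j)"
        using summand[OF i'(1), of j "d * m i"] unfolding x i' by blast
    qed
    then have "padic_val p (?c (m i) + (\<Sum>j\<in>{..e} - {m i}. ?c j)) = padic_val p (?c (m i))"
      using main by (intro padic_val_add_eq assms(1)) simp
    moreover have "coeff h (d * m i) = ?c (m i) + (\<Sum>j\<in>{..e} - {m i}. ?c j)"
      unfolding h_coeff using m_le[OF i] by (intro sum.remove) auto
    ultimately show ?thesis
      using main by simp
  qed
  have deg_h: "degree h = d * e"
    by (simp add: h_def degree_pcompose assms(2,9))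

  \<comment> \<open>Comparison of the two Newton polygons\<close>
  have "newton_polygon p h = (\<lambda>(x, y). (real d * x, y)) ` newton_polygon p g"
    unfolding newton_polygon_eq_lower_boundary A_def[symmetric]
  proof (rule lower_boundary_scale[where V = "v ` {..t}"])
    show "real d > 0"
      using d by simp
  next
    fix P assume "P \<in> v ` {..t}"
    then obtain i where i: "i \<le> t" "P = v i"
      by auto
    show "(real d * fst P, snd P) \<in> newton_points p h"
      unfolding newton_points_def mem_Collect_eq
      using h_vertex[OF i(1)] m_le[OF i(1)]
      by (intro exI[of _ "d * m i"] exI[of _ "y i"])
         (auto simp: deg_h i(2) v_def of_nat_diff algebra_simps)
  next
    fix x z assume xz: "(x, z) \<in> convex hull A"
    \<comment> \<open>The edge over \<open>x\<close> supplies the lowest point: it is a chord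
      between two vertices, and its line supports \<open>A\<close>.\<close>
    obtain i where i: "i < t" "x \<in> {fst (v i)..fst (v (Suc i))}"
      using edge_ex hullA_fst[OF xz] by auto
    have lt: "fst (v i) < fst (v (Suc i))"
      using mono i by simp
    have "(x, line i x) \<in> convex hull (v ` {..t})"
      unfolding line_def
      by (rule on_segment[OF convex_convex_hull _ _ lt i(2) edge[OF i(1)]]) (use i in \<open>auto intro: hull_inc\<close>)
    moreover have "(x, line i x) \<in> lower_boundary (convex hull A)"
      unfolding line_def
      by (rule segment_lower_boundary[OF _ _ lt edge[OF i(1)] sup[OF i(1)] i(2)])
         (use vA i in \<open>auto intro: hull_inc\<close>)
    moreover have "line i x \<le> z"
      using supporting_line_hull[OF sup[OF i(1)] xz] by (simp add: line_def)
    ultimately show "\<exists>y'\<le>z. (x, y') \<in> convex hull (v ` {..t}) \<and>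
        (x, y') \<in> lower_boundary (convex hull A)"
      by blast
  next
    fix P assume "P \<in> newton_points p h"
    then obtain k r where k: "k \<le> d * e" "P = (real (d * e - k), r)" "padic_val p (coeff h k) = ereal r"
      by (auto simp: newton_points_def deg_h)
    \<comment> \<open>Dividing the abscissa \<open>d * e - k\<close> by \<open>d\<close> gives
      \<open>e - k / d\<close>, where \<open>h_ge\<close> compares the coefficient with the edge
      lines.\<close>
    define x where "x = real e - real k / real d"
    have "real k \<le> real d * real e"
      using k(1) by (simp flip: of_nat_mult)
    then have x: "fst P / real d = x" "x \<in> {0..real e}"
      using k d by (auto simp: x_def of_nat_diff field_simps)
    obtain i where i: "i < t" "x \<in> {fst (v i)..fst (v (Suc i))}"
      using edge_ex x(2) by auto
    have lt: "fst (v i) < fst (v (Suc i))"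
      using mono i by simp
    have "(x, line i x) \<in> convex hull A"
      unfolding line_def
      by (rule on_segment[OF convex_convex_hull _ _ lt i(2) edge[OF i(1)]])
         (use vA i in \<open>auto intro: hull_inc\<close>)
    moreover have "line i x \<le> snd P"
      using h_ge[OF i(1), of k] k by (simp add: x_def)
    ultimately show "\<exists>y\<le>snd P. (fst P / real d, y) \<in> convex hull A"
      unfolding x by blast
  qed
  then have nv: "newton_vertices p h = (\<lambda>(x, y). (real d * x, y)) ` v ` {..t}"
    unfolding vs using deg_h d assms(2) by (intro newton_vertices_scale) auto
  \<comment> \<open>Since \<open>m t = 0\<close>, the constant coefficient belongs to the last
    vertex and has finite valuation.\<close>
  have "coeff h 0 \<noteq> 0"
    using h_vertex[of t] assms(5) by auto
  moreover have "(\<lambda>i. (real d * (real e - real (m i)), padic_val p (coeff g (m i)))) ` {..t} =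
      (\<lambda>(x, y). (x, ereal y)) ` newton_vertices p h"
    unfolding nv image_image using w by (intro image_cong) (auto simp: v_def)
  moreover have "real d * (real e - real (m i)) < real d * (real e - real (m j))"
    if "i < j" "j \<le> t" for i j
    using mono[OF that] d by (simp add: v_def)
  ultimately show ?thesis
    unfolding h_def[symmetric] successive_newton_vertices_def
    by (auto simp: sorted_wrt_iff_nth_less atLeast0LessThan lessThan_Suc_atMost simp del: upt_Suc)
qed

end
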